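(* For real $a\ge 0$ and $x\in(0,\infty)$, let $$f_a(x)=\frac{1}{2}\ln(2\pi)-x+\left(x-\frac{1}{2}\right)\ln x-\ln\Gamma(x)+\frac{1}{12}\psi'(x+a).$$ Let $\alpha\ge0$ and $\beta\ge0$ be real numbers. Then $f_\alpha$ is completely monotonic on $(0,\infty)$ if and only if $\alpha=0$, and $-f_\beta$ is completely monotonic on $(0,\infty)$ if and only if $\beta\ge\frac12$.
   Context: $\Gamma(x)=\int_0^\infty t^{x-1}e^{-t}\,dt$ for $x>0$ is the gamma function, $\psi(x)=\Gamma'(x)/\Gamma(x)$ is the di-gamma function, and $\psi'$ is its derivative (the tri-gamma function). A real function $f$ is completely monotonic on an interval $I$ if it has derivatives of all orders on $I$ and $0\le(-1)^n f^{(n)}(x)<\infty$ for all $x\in I$ and all integers $n\ge0$. *)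

theory Defs
  imports "HOL-Analysis.Analysis"
begin

(* The function g n is the n-th derivative of f on I.  Derivatives are taken within I, hence are
   one-sided at end points that belong to I; on a nondegenerate interval they are unique, and on
   an open one they are the ordinary derivatives (see completely_monotonic_on_open_iff).
   Finiteness of the derivatives is automatic because they are real-valued. *)
definition completely_monotonic_on :: "real set \<Rightarrow> (real \<Rightarrow> real) \<Rightarrow> bool" where
  "completely_monotonic_on I f \<longleftrightarrow>
     is_interval I \<and>
     (\<exists>g :: nat \<Rightarrow> real \<Rightarrow> real.
        (\<forall>x\<in>I. g 0 x = f x) \<and>
        (\<forall>n. \<forall>x\<in>I. (g n has_real_derivative g (Suc n) x) (at x within I)) \<and>
        (\<forall>n. \<forall>x\<in>I. 0 \<le> (-1) ^ n * g n x))"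

lemma completely_monotonic_on_open_iff:
  assumes "open I" "is_interval I"
  shows "completely_monotonic_on I f \<longleftrightarrow>
    (\<forall>n. \<forall>x\<in>I. (deriv ^^ n) f differentiable at x \<and> 0 \<le> (-1) ^ n * (deriv ^^ n) f x)"
proof
  assume "completely_monotonic_on I f"
  then obtain g where g0: "\<And>x. x \<in> I \<Longrightarrow> g 0 x = f x"
    and gS: "\<And>n x. x \<in> I \<Longrightarrow> (g n has_real_derivative g (Suc n) x) (at x within I)"
    and sgn: "\<And>n x. x \<in> I \<Longrightarrow> 0 \<le> (-1) ^ n * g n x"
    unfolding completely_monotonic_on_def by blast
  have gS': "(g n has_real_derivative g (Suc n) x) (at x)" if "x \<in> I" for n x
    using gS[OF that, of n] at_within_open[OF that \<open>open I\<close>] by simp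
  have transfer: "(h has_real_derivative g (Suc n) x) (at x)"
    if "x \<in> I" "\<And>y. y \<in> I \<Longrightarrow> h y = g n y" for h n x
    by (rule has_field_derivative_transform_within_open[OF gS'[OF that(1)] \<open>open I\<close> that(1)])
      (simp add: that(2))
  have eq: "\<forall>x\<in>I. (deriv ^^ n) f x = g n x" for n
  proof (induction n)
    case 0
    then show ?case by (simp add: g0)
  next
    case (Suc n)
    then show ?case using DERIV_imp_deriv[OF transfer] by simp
  qed
  show "\<forall>n. \<forall>x\<in>I. (deriv ^^ n) f differentiable at x \<and> 0 \<le> (-1) ^ n * (deriv ^^ n) f x"
  proof (intro allI ballI conjI)
    fix n x assume x: "x \<in> I"
    have "((deriv ^^ n) f has_real_derivative g (Suc n) x) (at x)"
      by (rule transfer[OF x]) (use eq in blast)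
    then show "(deriv ^^ n) f differentiable at x"
      unfolding real_differentiable_def by blast
    show "0 \<le> (-1) ^ n * (deriv ^^ n) f x"
      using eq sgn[OF x] x by simp
  qed
next
  assume *: "\<forall>n. \<forall>x\<in>I. (deriv ^^ n) f differentiable at x \<and> 0 \<le> (-1) ^ n * (deriv ^^ n) f x"
  have "((deriv ^^ n) f has_real_derivative (deriv ^^ Suc n) f x) (at x within I)"
    if "x \<in> I" for n x
  proof -
    have "(deriv ^^ n) f differentiable at x"
      using * that by blast
    then obtain D where D: "((deriv ^^ n) f has_real_derivative D) (at x)"
      unfolding real_differentiable_def ..
    have "(deriv ^^ Suc n) f x = D"
      using DERIV_imp_deriv[OF D] by simp
    with D show ?thesis
      by (simp del: funpow.simps add: has_field_derivative_at_within)
  qed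
  then show "completely_monotonic_on I f"
    unfolding completely_monotonic_on_def using * \<open>is_interval I\<close>
    by (intro conjI exI[of _ "\<lambda>n. (deriv ^^ n) f"]) (simp_all del: funpow.simps(2))
qed

definition stirling_remainder :: "real \<Rightarrow> real \<Rightarrow> real" where
  "stirling_remainder a x =
     1/2 * ln (2 * pi) - x + (x - 1/2) * ln x - ln (Gamma x) + 1/12 * deriv Digamma (x + a)"

end

(* The second derivative of the Stirling remainder tends to 0 at infinity, and its difference over a
   unit step is the rational function (1/2) (1/(x+a)^4 - 1/(x(x+1))^2).  For a = 0 this function, and
   for a >= 1/2 its negative, is a combination with nonnegative coefficients of products of functions
   1/(x+b) with b >= 0, hence completely monotonic; summing the steps to infinity fixes the signs of
   all derivatives from the second on.  Orders 1 and 0 follow from monotonicity and the limit 0 at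
   infinity; for order 0 this limit is Stirling's formula, which is obtained from the boundedness of
   the remainder together with Legendre's duplication formula.

   Conversely, for a > 0 the remainder tends to minus infinity at 0, where (ln x)/2 dominates, and for
   a < 1/2 the rational function is positive for large x, so the second derivative is positive there. *)
theory Submission
  imports Defs "HOL-Real_Asymp.Real_Asymp"
begin

section \<open>Completely monotonic functions\<close>

lemma completely_monotonic_on_cong:
  assumes "\<And>x. x \<in> I \<Longrightarrow> f x = g x"
  shows "completely_monotonic_on I f \<longleftrightarrow> completely_monotonic_on I g"
  using assms by (simp add: completely_monotonic_on_def)

lemma completely_monotonic_on_nonneg:
  assumes "completely_monotonic_on I f" "x \<in> I"
  shows "0 \<le> f x"
proof -
  from assms(1) obtain g where "\<forall>x\<in>I. g 0 x = f x" "\<forall>n. \<forall>x\<in>I. 0 \<le> (-1) ^ n * g n x"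
    unfolding completely_monotonic_on_def by blast
  with assms(2) show ?thesis
    by (metis mult_1 power_0)
qed

text \<open>A class of nonnegative functions closed under taking minus the derivative suffices:
  iterating a chosen closure step yields the n-th derivative up to the factor (-1)^n.\<close>

lemma completely_monotonic_on_coinduct:
  assumes I: "is_interval I" and f: "P f"
    and nonneg: "\<And>h x. P h \<Longrightarrow> x \<in> I \<Longrightarrow> 0 \<le> h x"
    and step: "\<And>h. P h \<Longrightarrow> \<exists>h'. P h' \<and> (\<forall>x\<in>I. (h has_real_derivative - h' x) (at x within I))"
  shows "completely_monotonic_on I f"
proof -
  define d where
    "d h = (SOME h'. P h' \<and> (\<forall>x\<in>I. (h has_real_derivative - h' x) (at x within I)))" for h
  have d: "P (d h)" "x \<in> I \<Longrightarrow> (h has_real_derivative - d h x) (at x within I)" if "P h" for h x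
    using someI_ex[OF step[OF that]] unfolding d_def by auto
  have P: "P ((d ^^ n) f)" for n
    by (induction n) (auto intro: f d)
  define g where "g n x = (-1) ^ n * (d ^^ n) f x" for n x
  have "(g n has_real_derivative g (Suc n) x) (at x within I)" if "x \<in> I" for n x
    unfolding g_def using DERIV_cmult[OF d(2)[OF P that], of "(-1) ^ n" n] by simp
  moreover have "0 \<le> (-1) ^ n * g n x" if "x \<in> I" for n x
    using nonneg[OF P that] by (simp add: g_def flip: mult.assoc power_mult_distrib)
  ultimately show ?thesis
    unfolding completely_monotonic_on_def using I
    by (intro conjI exI[of _ g]) (auto simp: g_def)
qed

text \<open>Derivatives on an open set are unique, so the signs carry over to any explicit formulas
  \<open>G\<close> for them.\<close>

lemma completely_monotonic_on_derivatives_nonneg: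
  assumes cm: "completely_monotonic_on I f" and I: "open I"
    and G0: "\<And>x. x \<in> I \<Longrightarrow> G 0 x = f x"
    and GS: "\<And>n x. x \<in> I \<Longrightarrow> (G n has_real_derivative G (Suc n) x) (at x)"
    and x: "x \<in> I"
  shows "0 \<le> (-1) ^ n * G n x"
proof -
  have eq: "\<forall>y\<in>I. (deriv ^^ n) f y = G n y" for n
  proof (induction n)
    case (Suc n)
    have "((deriv ^^ n) f has_real_derivative G (Suc n) y) (at y)" if "y \<in> I" for y
      by (rule has_field_derivative_transform_within_open[OF GS[OF that] I that]) (use Suc in simp)
    then show ?case
      by (simp add: DERIV_imp_deriv)
  qed (simp add: G0)
  have "is_interval I"
    using cm by (simp add: completely_monotonic_on_def)
  with cm I eq x show ?thesis
    by (simp add: completely_monotonic_on_open_iff)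
qed

text \<open>An inductive class turns closure under minus the derivative into a structural induction.
  Its rules dictate the shape of the factorisations of \<open>step_deriv\<close> below, including
  terms such as \<open>1 / (x + 0)\<close>.\<close>

inductive shift_rational :: "(real \<Rightarrow> real) \<Rightarrow> bool" where
  const: "0 \<le> c \<Longrightarrow> shift_rational (\<lambda>_. c)"
| recip: "0 \<le> a \<Longrightarrow> shift_rational (\<lambda>x. 1 / (x + a))"
| add: "shift_rational f \<Longrightarrow> shift_rational g \<Longrightarrow> shift_rational (\<lambda>x. f x + g x)"
| mult: "shift_rational f \<Longrightarrow> shift_rational g \<Longrightarrow> shift_rational (\<lambda>x. f x * g x)"

lemma shift_rational_nonneg: "shift_rational f \<Longrightarrow> 0 < x \<Longrightarrow> 0 \<le> f x"
  by (induction rule: shift_rational.induct) auto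

text \<open>Minus the derivative of 1/(x + a) is its square, and the product rule only creates sums
  of products.\<close>

lemma shift_rational_deriv:
  assumes "shift_rational f"
  shows "\<exists>f'. shift_rational f' \<and> (\<forall>x>0. (f has_real_derivative - f' x) (at x))"
  using assms
proof induction
  case (const c)
  show ?case
    by (intro exI[of _ "\<lambda>_. 0"]) (auto intro: shift_rational.const)
next
  case (recip a)
  have "((\<lambda>x. 1 / (x + a)) has_real_derivative - (1 / (x + a) * (1 / (x + a)))) (at x)"
    if "0 < x" for x
    using that recip by (auto intro!: derivative_eq_intros)
  then show ?case
    using recip by (intro exI[of _ "\<lambda>x. 1 / (x + a) * (1 / (x + a))"])
      (auto intro!: shift_rational.mult shift_rational.recip simp del: times_divide_eq_left times_divide_eq_right)
next
  case (add f g)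
  then obtain f' g' where *: "shift_rational f'" "shift_rational g'"
    "\<And>x. 0 < x \<Longrightarrow> (f has_real_derivative - f' x) (at x)"
    "\<And>x. 0 < x \<Longrightarrow> (g has_real_derivative - g' x) (at x)"
    by blast
  then show ?case
    by (intro exI[of _ "\<lambda>x. f' x + g' x"])
      (auto intro!: shift_rational.intros derivative_eq_intros)
next
  case (mult f g)
  then obtain f' g' where *: "shift_rational f'" "shift_rational g'"
    "\<And>x. 0 < x \<Longrightarrow> (f has_real_derivative - f' x) (at x)"
    "\<And>x. 0 < x \<Longrightarrow> (g has_real_derivative - g' x) (at x)"
    by blast
  with mult show ?case
    by (intro exI[of _ "\<lambda>x. f' x * g x + f x * g' x"])
      (auto intro!: shift_rational.intros derivative_eq_intros)
qed

lemma shift_rational_completely_monotonic: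
  "shift_rational f \<Longrightarrow> completely_monotonic_on {0<..} f"
proof (rule completely_monotonic_on_coinduct[of _ shift_rational])
  fix h assume "shift_rational h"
  then show "\<exists>h'. shift_rational h' \<and>
      (\<forall>x\<in>{0<..}. (h has_real_derivative - h' x) (at x within {0<..}))"
    using shift_rational_deriv has_field_derivative_at_within by (metis greaterThan_iff)
qed (auto intro: shift_rational_nonneg simp: is_interval_io)

section \<open>Sign of a function from its limit at infinity\<close>

text \<open>Along x, x + 1, x + 2, ... the values decrease to 0, so the first of them is
  nonnegative.\<close>

lemma nonneg_if_step_antimono_tendsto_0:
  fixes F :: "real \<Rightarrow> real"
  assumes lim: "(F \<longlongrightarrow> 0) at_top" and step: "\<And>y. x \<le> y \<Longrightarrow> F (y + 1) \<le> F y"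
  shows "0 \<le> F x"
proof -
  have le: "F (x + real k) \<le> F x" for k
  proof (induction k)
    case (Suc k)
    then show ?case
      using step[of "x + real k"] by (simp add: add.assoc add.commute[of 1])
  qed simp
  have "filterlim (\<lambda>k. x + real k) at_top sequentially"
    by real_asymp
  from filterlim_compose[OF lim this] show ?thesis
    by (rule tendsto_upperbound) (auto simp: le)
qed

lemma nonneg_if_deriv_nonpos_tendsto_0:
  fixes F :: "real \<Rightarrow> real"
  assumes lim: "(F \<longlongrightarrow> 0) at_top"
    and der: "\<And>y. x \<le> y \<Longrightarrow> (F has_real_derivative F' y) (at y) \<and> F' y \<le> 0"
  shows "0 \<le> F x"
  using lim
proof (rule nonneg_if_step_antimono_tendsto_0)
  fix y assume "x \<le> y"
  then show "F (y + 1) \<le> F y"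
    by (intro DERIV_nonpos_imp_nonincreasing[of y "y + 1" F]) (use der in \<open>auto dest: order.trans\<close>)
qed

section \<open>Polygamma functions at infinity\<close>

lemma pos_not_nonpos_Ints: "0 < (x::real) \<Longrightarrow> x \<notin> \<int>\<^sub>\<le>\<^sub>0"
  by (auto elim!: nonpos_Ints_cases)

text \<open>On the positive axis even orders n > 0 are negative and increasing, odd orders positive
  and decreasing.\<close>

lemma abs_Polygamma_real_antimono:
  fixes x y :: real
  assumes "0 < x" "x \<le> y" "0 < n"
  shows "\<bar>Polygamma n y\<bar> \<le> \<bar>Polygamma n x\<bar>"
proof (cases "even n")
  case True
  then show ?thesis
    using assms Polygamma_real_strict_mono[of x y n] Polygamma_real_even_neg[of y n]
    by (cases "x = y") auto
next
  case False
  then show ?thesis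
    using assms Polygamma_real_strict_antimono[of x y n]
      Polygamma_real_odd_pos[of y n] pos_not_nonpos_Ints[of y]
    by (cases "x = y") auto
qed

text \<open>By the recurrence, the increment of \<open>Polygamma n\<close> over [x, x + 1] is (-1)^n
  n!/x^(n+1). By the mean value theorem it is also \<open>Polygamma (Suc n) z\<close> for some z < x
  + 1, and absolute values decrease from z to x + 1.\<close>

lemma abs_Polygamma_plus1_le:
  fixes x :: real
  assumes "0 < x"
  shows "\<bar>Polygamma (Suc n) (x + 1)\<bar> \<le> fact n / x ^ Suc n"
proof -
  have "\<exists>z>x. z < x + 1 \<and> Polygamma n (x + 1) - Polygamma n x = (x + 1 - x) * Polygamma (Suc n) z"
    using assms by (intro MVT2) (auto intro!: derivative_intros pos_not_nonpos_Ints)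
  then obtain z where z: "x < z" "z < x + 1"
    and "Polygamma n (x + 1) - Polygamma n x = Polygamma (Suc n) z"
    by auto
  then have "Polygamma (Suc n) z = (-1) ^ n * fact n / x ^ Suc n"
    using assms by (simp add: Polygamma_plus1)
  then have "\<bar>Polygamma (Suc n) z\<bar> = fact n / x ^ Suc n"
    using assms by (simp only: abs_mult abs_divide power_abs) simp
  moreover have "\<bar>Polygamma (Suc n) (x + 1)\<bar> \<le> \<bar>Polygamma (Suc n) z\<bar>"
    using z assms by (intro abs_Polygamma_real_antimono) auto
  ultimately show ?thesis
    by simp
qed

lemma Polygamma_Suc_tendsto_0: "((\<lambda>x::real. Polygamma (Suc n) (x + a)) \<longlongrightarrow> 0) at_top"
proof (rule Lim_null_comparison)
  show "\<forall>\<^sub>F x in at_top. norm (Polygamma (Suc n) (x + a)) \<le> fact n / (x + a - 1) ^ Suc n"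
    \<comment> \<open>The bound is applied at x + a - 1, which is positive from here on.\<close>
    using eventually_gt_at_top[of "1 - a"]
    by eventually_elim (use abs_Polygamma_plus1_le[of "_ + a - 1" n] in simp)
  show "((\<lambda>x. fact n / (x + a - 1) ^ Suc n) \<longlongrightarrow> 0) at_top"
    by (intro tendsto_divide_0[OF tendsto_const] filterlim_at_top_imp_at_infinity
        filterlim_pow_at_top) (simp, real_asymp)
qed

text \<open>The increment ln x of \<open>ln_Gamma\<close> over [x, x + 1] equals
  \<open>Digamma z\<close> for some z in between, which lies between \<open>Digamma x\<close> and
  \<open>Digamma (x + 1)\<close>, that is, \<open>Digamma x + 1 / x\<close>.\<close>

lemma ln_minus_Digamma_bounds:
  fixes x :: real
  assumes "0 < x"
  shows "0 \<le> ln x - Digamma x" "ln x - Digamma x \<le> 1 / x"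
proof -
  have "\<exists>z>x. z < x + 1 \<and> ln_Gamma (x + 1) - ln_Gamma x = (x + 1 - x) * Digamma z"
    using assms by (intro MVT2) (auto intro!: derivative_intros)
  then obtain z where z: "x < z" "z < x + 1" and eq: "ln_Gamma (x + 1) - ln_Gamma x = Digamma z"
    by auto
  have "ln_Gamma (x + 1) - ln_Gamma x = ln x"
    using assms Gamma_plus1[of x] pos_not_nonpos_Ints[of x] Gamma_real_pos[of x]
    by (simp add: ln_Gamma_real_pos ln_mult del: Gamma_real_pos)
  moreover have "Digamma x \<le> Digamma z" "Digamma z \<le> Digamma (x + 1)"
    using z assms by (auto intro: Digamma_real_mono)
  moreover have "Digamma (x + 1) = Digamma x + 1 / x"
    using assms by (simp add: Digamma_plus1)
  ultimately show "0 \<le> ln x - Digamma x" "ln x - Digamma x \<le> 1 / x"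
    using eq by auto
qed

lemma ln_minus_Digamma_tendsto_0: "((\<lambda>x::real. ln x - Digamma x) \<longlongrightarrow> 0) at_top"
proof (rule tendsto_sandwich)
  show "\<forall>\<^sub>F x::real in at_top. 0 \<le> ln x - Digamma x"
    using eventually_gt_at_top[of 0] by eventually_elim (rule ln_minus_Digamma_bounds)
  show "\<forall>\<^sub>F x::real in at_top. ln x - Digamma x \<le> 1 / x"
    using eventually_gt_at_top[of 0] by eventually_elim (rule ln_minus_Digamma_bounds)
  show "((\<lambda>x::real. 1 / x) \<longlongrightarrow> 0) at_top"
    by real_asymp
qed simp

section \<open>The derivatives of the Stirling remainder\<close>

text \<open>The n-th derivative of 1/x; at the same time the increment of \<open>Polygamma n\<close>
  from x to x + 1.\<close>

definition recip_deriv :: "nat \<Rightarrow> real \<Rightarrow> real" where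
  "recip_deriv n x = (-1) ^ n * fact n / x ^ Suc n"

lemma has_derivative_recip_deriv:
  assumes "x \<noteq> 0"
  shows "(recip_deriv n has_real_derivative recip_deriv (Suc n) x) (at x)"
proof -
  have "((\<lambda>x. inverse x ^ Suc n) has_real_derivative
      real (Suc n) * (- (inverse x ^ 2) * inverse x ^ n)) (at x)"
    using DERIV_power[OF DERIV_inverse[OF assms], of "Suc n"] by (simp add: numeral_2_eq_2)
  from DERIV_cmult[OF this, of "(-1) ^ n * fact n"] show ?thesis
    by (simp add: recip_deriv_def[abs_def] divide_inverse power_inverse power2_eq_square algebra_simps)
qed

lemma DERIV_recip_deriv_add:
  assumes "x + b \<noteq> 0"
  shows "((\<lambda>x. recip_deriv n (x + b)) has_real_derivative recip_deriv (Suc n) (x + b)) (at x)"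
  using has_derivative_recip_deriv[OF assms] by (simp add: DERIV_shift)

lemma recip_deriv_tendsto_0: "(recip_deriv n \<longlongrightarrow> 0) at_top"
  unfolding recip_deriv_def[abs_def]
  by (intro tendsto_divide_0[OF tendsto_const] filterlim_at_top_imp_at_infinity
        filterlim_pow_at_top) (auto simp: filterlim_ident)

text \<open>The \<open>n\<close>-th derivative of the Stirling remainder with the weight \<open>1/12\<close> of the trigamma term replaced by \<open>e\<close>; the case \<open>e = 0\<close> is the error term of Stirling's formula.\<close>

fun stirling_deriv :: "real \<Rightarrow> real \<Rightarrow> nat \<Rightarrow> real \<Rightarrow> real" where
  "stirling_deriv e a 0 =
    (\<lambda>x. 1/2 * ln (2 * pi) - x + (x - 1/2) * ln x - ln_Gamma x + e * Polygamma 1 (x + a))"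
| "stirling_deriv e a (Suc 0) =
    (\<lambda>x. ln x - 1 / (2 * x) - Digamma x + e * Polygamma 2 (x + a))"
| "stirling_deriv e a (Suc (Suc n)) =
    (\<lambda>x. recip_deriv n x - recip_deriv (Suc n) x / 2
      - Polygamma (Suc n) x + e * Polygamma (n + 3) (x + a))"

lemma stirling_remainder_eq:
  assumes "0 < x" "0 \<le> a"
  shows "stirling_remainder a x = stirling_deriv (1/12) a 0 x"
  using assms pos_not_nonpos_Ints[of "x + a"]
  by (simp add: stirling_remainder_def ln_Gamma_real_pos deriv_Polygamma)

lemma DERIV_Polygamma_add:
  fixes x a :: real
  assumes "0 < x + a"
  shows "((\<lambda>x. Polygamma n (x + a)) has_real_derivative Polygamma (Suc n) (x + a)) (at x)"
  using has_field_derivative_Polygamma[OF pos_not_nonpos_Ints[OF assms], of n UNIV]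
  by (simp only: DERIV_shift)

lemma DERIV_stirling_deriv:
  assumes "0 < x" "0 \<le> a"
  shows "(stirling_deriv e a n has_real_derivative stirling_deriv e a (Suc n) x) (at x)"
proof -
  have xa: "0 < x + a"
    using assms by simp
  consider "n = 0" | "n = 1" | m where "n = Suc (Suc m)"
    by (metis One_nat_def not0_implies_Suc)
  then show ?thesis
  proof cases
    case 1
    then show ?thesis
      using assms by (auto intro!: derivative_eq_intros DERIV_Polygamma_add[OF xa]
        simp: field_simps eval_nat_numeral)
  next
    case 2
    then show ?thesis
      using assms by (auto intro!: derivative_eq_intros DERIV_Polygamma_add[OF xa] pos_not_nonpos_Ints
        simp: field_simps eval_nat_numeral recip_deriv_def)
  next
    case 3
    then show ?thesis
      using assms by (auto intro!: derivative_eq_intros DERIV_Polygamma_add[OF xa] pos_not_nonpos_Ints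
        has_derivative_recip_deriv simp: eval_nat_numeral)
  qed
qed

text \<open>From order 1 on every term vanishes at infinity once ln x is paired with
  \<open>Digamma x\<close>. Order 0 requires Stirling's formula and is treated in
  \<open>stirling_deriv_tendsto_0\<close>.\<close>

lemma stirling_deriv_Suc_tendsto_0: "(stirling_deriv e a (Suc n) \<longlongrightarrow> 0) at_top"
proof (cases n)
  case 0
  have "((\<lambda>x. ln x - Digamma x - 1 / (2 * x) + e * Polygamma (Suc 1) (x + a)) \<longlongrightarrow> 0 - 0 + e * 0) at_top"
    by (intro tendsto_intros ln_minus_Digamma_tendsto_0 Polygamma_Suc_tendsto_0) real_asymp
  then show ?thesis
    using 0 by (simp add: numeral_2_eq_2 algebra_simps)
next
  case (Suc m)
  have "((\<lambda>x. recip_deriv m x - recip_deriv (Suc m) x / 2 - Polygamma (Suc m) (x + 0)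
      + e * Polygamma (Suc (m + 2)) (x + a)) \<longlongrightarrow> 0 - 0 / 2 - 0 + e * 0) at_top"
    by (intro tendsto_intros recip_deriv_tendsto_0 Polygamma_Suc_tendsto_0) simp
  then show ?thesis
    using Suc by (simp add: eval_nat_numeral)
qed

text \<open>The n-th derivative of F''(x) - F''(x + 1), where F is
  \<open>stirling_deriv e a 0\<close>; the recurrence of the polygamma functions makes it
  rational.\<close>

definition step_deriv :: "real \<Rightarrow> real \<Rightarrow> nat \<Rightarrow> real \<Rightarrow> real" where
  "step_deriv e a n x = recip_deriv n x - recip_deriv n (x + 1)
    + (recip_deriv (Suc n) x + recip_deriv (Suc n) (x + 1)) / 2 - e * recip_deriv (n + 3) (x + a)"

lemma stirling_deriv_diff:
  assumes "0 < x" "0 \<le> a"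
  shows "stirling_deriv e a (Suc (Suc n)) x - stirling_deriv e a (Suc (Suc n)) (x + 1) =
    step_deriv e a n x"
proof -
  have P: "Polygamma m (y + 1) = Polygamma m y + recip_deriv m y" if "0 < y" for m and y :: real
    using that by (simp add: Polygamma_plus1 recip_deriv_def)
  show ?thesis
    using assms P[of x "Suc n"] P[of "x + a" "n + 3"]
    by (simp add: step_deriv_def algebra_simps)
qed

lemma DERIV_step_deriv:
  assumes "0 < x" "0 \<le> a"
  shows "(step_deriv e a n has_real_derivative step_deriv e a (Suc n) x) (at x)"
  unfolding step_deriv_def[abs_def] using assms
  by (auto intro!: derivative_eq_intros has_derivative_recip_deriv DERIV_recip_deriv_add
      simp: eval_nat_numeral)

text \<open>For p = 1/x and q = 1/(x + 1) the relation p - q = pq collapses the first terms to a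
  square. The weight e = 1/12 gives 6e = 1/2, so that both coefficients match and a difference of
  squares results.\<close>

lemma step_deriv_0:
  assumes "0 < x" "0 \<le> a"
  shows "step_deriv e a 0 x = 6 * e * (1 / (x + a)) ^ 4 - (1 / (x * (x + 1))) ^ 2 / 2"
proof -
  define p q where "p = 1 / x" and "q = 1 / (x + 1)"
  have pq: "p - q = p * q"
    using assms by (simp add: p_def q_def field_simps)
  have "step_deriv e a 0 x = (p - q) - (p ^ 2 + q ^ 2) / 2 + 6 * e * (1 / (x + a)) ^ 4"
    by (simp add: step_deriv_def recip_deriv_def p_def q_def power_divide eval_nat_numeral
        fact_numeral add_divide_distrib diff_divide_distrib)
  also have "(p - q) - (p ^ 2 + q ^ 2) / 2 = (p - q) - ((p - q) ^ 2 + 2 * (p * q)) / 2"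
    by (simp add: power2_eq_square algebra_simps)
  also have "\<dots> = - ((p * q) ^ 2) / 2"
    unfolding pq by (simp add: field_simps)
  finally show ?thesis
    by (simp add: p_def q_def)
qed

text \<open>The factor \<sigma> is 1 or -1 in the applications and selects the function or its
  negative. Complete monotonicity of \<open>R\<close> says that the unit steps have the right sign
  at every order, and the limit 0 transfers it to the values.\<close>

lemma stirling_deriv_sign:
  assumes R: "shift_rational R" and a: "0 \<le> a"
    and eq: "\<And>x. 0 < x \<Longrightarrow> \<sigma> * step_deriv e a 0 x = R x"
    and x: "0 < x"
  shows "0 \<le> \<sigma> * (-1) ^ n * stirling_deriv e a (Suc (Suc n)) x"
proof (rule nonneg_if_step_antimono_tendsto_0
    [where F = "\<lambda>x. \<sigma> * (-1) ^ n * stirling_deriv e a (Suc (Suc n)) x"])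
  show "((\<lambda>x. \<sigma> * (-1) ^ n * stirling_deriv e a (Suc (Suc n)) x) \<longlongrightarrow> 0) at_top"
    by (intro tendsto_mult_right_zero stirling_deriv_Suc_tendsto_0)
next
  fix y assume "x \<le> y"
  with x have y: "0 < y"
    by simp
  have "0 \<le> (-1) ^ n * (\<lambda>n x. \<sigma> * step_deriv e a n x) n y"
    using y a eq
    by (intro completely_monotonic_on_derivatives_nonneg
        [OF shift_rational_completely_monotonic[OF R]])
      (auto intro!: DERIV_cmult DERIV_step_deriv)
  then show "\<sigma> * (-1) ^ n * stirling_deriv e a (Suc (Suc n)) (y + 1)
      \<le> \<sigma> * (-1) ^ n * stirling_deriv e a (Suc (Suc n)) y"
    by (simp add: stirling_deriv_diff[OF y a, symmetric] algebra_simps)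
qed

lemma stirling_deriv_sign_1:
  assumes R: "shift_rational R" and a: "0 \<le> a"
    and eq: "\<And>x. 0 < x \<Longrightarrow> \<sigma> * step_deriv e a 0 x = R x"
    and x: "0 < x"
  shows "\<sigma> * stirling_deriv e a (Suc 0) x \<le> 0"
proof -
  have "0 \<le> - \<sigma> * stirling_deriv e a (Suc 0) x"
  proof (rule nonneg_if_deriv_nonpos_tendsto_0
      [where F = "\<lambda>x. - \<sigma> * stirling_deriv e a (Suc 0) x"])
    show "((\<lambda>x. - \<sigma> * stirling_deriv e a (Suc 0) x) \<longlongrightarrow> 0) at_top"
      by (intro tendsto_mult_right_zero stirling_deriv_Suc_tendsto_0)
  next
    fix y assume "x \<le> y"
    with x have y: "0 < y"
      by simp
    show "((\<lambda>x. - \<sigma> * stirling_deriv e a (Suc 0) x) has_real_derivative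
        - \<sigma> * stirling_deriv e a (Suc (Suc 0)) y) (at y) \<and>
        - \<sigma> * stirling_deriv e a (Suc (Suc 0)) y \<le> 0"
      using DERIV_cmult[OF DERIV_stirling_deriv[OF y a], of "- \<sigma>" e "Suc 0"]
        stirling_deriv_sign[OF R a eq y, of 0] by simp
  qed
  then show ?thesis
    by simp
qed

text \<open>Only the sign of the first derivative enters, so this is available before the limit at
  order 0 is known and can serve in the proof of Stirling's formula.\<close>

lemma stirling_deriv_antimono:
  assumes R: "shift_rational R" and a: "0 \<le> a"
    and eq: "\<And>x. 0 < x \<Longrightarrow> \<sigma> * step_deriv e a 0 x = R x"
    and x: "0 < x" "x \<le> y"
  shows "\<sigma> * stirling_deriv e a 0 y \<le> \<sigma> * stirling_deriv e a 0 x"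
proof (rule DERIV_nonpos_imp_nonincreasing[OF x(2)])
  fix z assume "x \<le> z"
  with x have z: "0 < z"
    by simp
  show "\<exists>D. ((\<lambda>x. \<sigma> * stirling_deriv e a 0 x) has_real_derivative D) (at z) \<and> D \<le> 0"
    using DERIV_cmult[OF DERIV_stirling_deriv[OF z a], of \<sigma> e 0]
      stirling_deriv_sign_1[OF R a eq z] by blast
qed

section \<open>Factorisations of the unit-step function\<close>

lemma step_deriv_0_no_trigamma:
  "0 < x \<Longrightarrow> - 1 * step_deriv 0 0 0 x = 1/2 * ((1 / (x + 0) * (1 / (x + 1))) * (1 / (x + 0) * (1 / (x + 1))))"
  by (simp add: step_deriv_0 power2_eq_square)

text \<open>With p = 1/x and q = 1/(x + 1), p^4 - (pq)^2 = p^2 (p - q)(p + q), where p - q =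
  pq.\<close>

lemma step_deriv_0_unshifted:
  assumes "0 < x"
  shows "1 * step_deriv (1/12) 0 0 x =
    1/2 * (((1 / (x + 0) * (1 / (x + 0))) * (1 / (x + 0) * (1 / (x + 1)))) *
      (1 / (x + 0) + 1 / (x + 1)))"
proof -
  define p q where "p = 1 / x" and "q = 1 / (x + 1)"
  have pq: "p - q = p * q"
    using assms by (simp add: p_def q_def field_simps)
  have "step_deriv (1/12) 0 0 x = 1/2 * (p ^ 4 - (p * q) ^ 2)"
    using assms by (simp add: step_deriv_0 p_def q_def)
  also have "\<dots> = 1/2 * (p ^ 2 * (p - q) * (p + q))"
    by (simp add: eval_nat_numeral algebra_simps)
  finally show ?thesis
    unfolding pq by (simp add: p_def q_def power2_eq_square)
qed

text \<open>With r = 1/(x + a), (pq)^2 - r^4 = (pq - r^2)(pq + r^2). The first factor has numerator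
  (x + a)^2 - x(x + 1) = (2a - 1)x + a^2, which is where the threshold 1/2 originates.\<close>

lemma step_deriv_0_shifted:
  assumes "0 < x" "0 \<le> a"
  shows "- 1 * step_deriv (1/12) a 0 x =
    1/2 * (((2 * a - 1) * ((1 / (x + 1)) * ((1 / (x + a)) * (1 / (x + a)))) +
        a ^ 2 * (((1 / (x + 0)) * (1 / (x + 1))) * ((1 / (x + a)) * (1 / (x + a))))) *
      ((1 / (x + 0)) * (1 / (x + 1)) + (1 / (x + a)) * (1 / (x + a))))"
proof -
  define p q r where "p = 1 / x" and "q = 1 / (x + 1)" and "r = 1 / (x + a)"
  have eq: "p * q - r * r = (2 * a - 1) * (q * (r * r)) + a ^ 2 * ((p * q) * (r * r))"
  proof -
    have "(x + a) * r = 1" "x * p = 1" "(x + 1) * q = 1"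
      using assms by (auto simp: p_def q_def r_def)
    then show ?thesis
      by algebra
  qed
  have "- 1 * step_deriv (1/12) a 0 x = 1/2 * ((p * q) ^ 2 - r ^ 4)"
    using assms by (simp add: step_deriv_0 p_def q_def r_def)
  also have "\<dots> = 1/2 * ((p * q - r * r) * (p * q + r * r))"
    by (simp add: eval_nat_numeral algebra_simps)
  finally show ?thesis
    unfolding eq by (simp only: p_def q_def r_def add_0_right)
qed

section \<open>Stirling's formula\<close>

text \<open>Legendre's formula is taken in its complex form; at real arguments all factors are real
  and positive, so logarithms may be taken.\<close>

lemma ln_Gamma_real_duplication:
  fixes z :: real
  assumes z: "0 < z"
  shows "ln_Gamma z + ln_Gamma (z + 1/2) = (1 - 2 * z) * ln 2 + ln pi / 2 + ln_Gamma (2 * z)"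
proof -
  have "complex_of_real z \<notin> \<int>\<^sub>\<le>\<^sub>0" "complex_of_real z + 1/2 \<notin> \<int>\<^sub>\<le>\<^sub>0"
    using z by (auto elim!: nonpos_Ints_cases simp: complex_eq_iff)
  from Gamma_legendre_duplication[OF this]
  have "Gamma (complex_of_real z) * Gamma (complex_of_real (z + 1/2)) =
      complex_of_real (exp ((1 - 2 * z) * ln 2) * sqrt pi) * Gamma (complex_of_real (2 * z))"
    by (simp flip: exp_of_real)
  then have "Gamma z * Gamma (z + 1/2) = exp ((1 - 2 * z) * ln 2) * sqrt pi * Gamma (2 * z)"
    unfolding Gamma_complex_of_real of_real_mult[symmetric] of_real_eq_iff .
  then have "ln (Gamma z * Gamma (z + 1/2)) = ln (exp ((1 - 2 * z) * ln 2) * sqrt pi * Gamma (2 * z))"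
    by simp
  moreover have "Gamma z > 0" "Gamma (z + 1/2) > 0" "Gamma (2 * z) > 0"
    using z by (auto intro!: Gamma_real_pos simp del: Gamma_real_pos)
  ultimately show ?thesis
    using z by (simp add: ln_mult ln_Gamma_real_pos ln_sqrt del: Gamma_real_pos)
qed

text \<open>All Gamma terms cancel. If the error term has a limit L, the left side tends to L + L -
  L, while the right side tends to 0.\<close>

lemma stirling_duplication:
  assumes x: "0 < x"
  shows "stirling_deriv 0 0 0 x + stirling_deriv 0 0 0 (x + 1/2) - stirling_deriv 0 0 0 (2 * x) =
    x * (ln (x + 1/2) - ln x) - 1/2"
  using ln_Gamma_real_duplication[OF x] x
  by (simp add: ln_mult algebra_simps add_divide_distrib)

lemma stirling_tendsto_0: "(stirling_deriv 0 0 0 \<longlongrightarrow> 0) at_top"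
proof -
  let ?s = "stirling_deriv 0 0 0"
  have mono: "?s x \<le> ?s y" if "0 < x" "x \<le> y" for x y
  proof -
    have "- 1 * ?s y \<le> - 1 * ?s x"
      by (rule stirling_deriv_antimono[OF _ order.refl step_deriv_0_no_trigamma that])
        (intro shift_rational.intros; simp)
    then show ?thesis
      by simp
  qed
  \<comment> \<open>Adding the positive trigamma term turns the increasing error term into a
    decreasing function, whose value at 1 is therefore an upper bound.\<close>
  have "?s x \<le> stirling_deriv (1/12) 0 0 1" if "1 \<le> x" for x
  proof -
    have "?s x \<le> stirling_deriv (1/12) 0 0 x"
      using that Polygamma_real_odd_pos[of x 1] pos_not_nonpos_Ints[of x] by simp
    also have "\<dots> \<le> stirling_deriv (1/12) 0 0 1"
    proof -
      have "1 * stirling_deriv (1/12) 0 0 x \<le> 1 * stirling_deriv (1/12) 0 0 1"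
        by (rule stirling_deriv_antimono[OF _ order.refl step_deriv_0_unshifted zero_less_one that])
          (intro shift_rational.intros; simp)
      then show ?thesis
        by simp
    qed
    finally show ?thesis .
  qed
  then obtain B where B: "?s x \<le> B" if "1 \<le> x" for x
    by blast
  define S where "S n = ?s (real (Suc n))" for n
  have "incseq S"
    unfolding S_def by (intro incseq_SucI mono) auto
  moreover have "S n \<le> B" for n
    unfolding S_def by (rule B) simp
  ultimately obtain L where L: "S \<longlonglongrightarrow> L"
    using incseq_convergent by metis
  have half: "(\<lambda>n. ?s (real (Suc n) + 1/2)) \<longlonglongrightarrow> L"
  proof (rule tendsto_sandwich[OF _ _ L LIMSEQ_Suc[OF L]])
    show "\<forall>\<^sub>F n in sequentially. S n \<le> ?s (real (Suc n) + 1/2)"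
      unfolding S_def by (intro always_eventually allI mono) auto
    show "\<forall>\<^sub>F n in sequentially. ?s (real (Suc n) + 1/2) \<le> S (Suc n)"
      unfolding S_def by (intro always_eventually allI mono) auto
  qed
  have double: "(\<lambda>n. ?s (2 * real (Suc n))) \<longlonglongrightarrow> L"
  proof -
    \<comment> \<open>Since \<open>S n\<close> is the value at n + 1, the value at 2(n + 1) is
      \<open>S (2 * n + 1)\<close>.\<close>
    have "strict_mono (\<lambda>n. 2 * n + 1 :: nat)"
      by (auto intro: strict_monoI)
    from LIMSEQ_subseq_LIMSEQ[OF L this] show ?thesis
      by (simp add: o_def S_def algebra_simps del: stirling_deriv.simps)
  qed
  have "(\<lambda>n. S n + ?s (real (Suc n) + 1/2) - ?s (2 * real (Suc n))) \<longlonglongrightarrow> L + L - L"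
    by (intro tendsto_intros L half double)
  moreover have "(\<lambda>n. S n + ?s (real (Suc n) + 1/2) - ?s (2 * real (Suc n))) \<longlonglongrightarrow> 0"
  proof -
    have "(\<lambda>n. real (Suc n) * (ln (real (Suc n) + 1/2) - ln (real (Suc n))) - 1/2) \<longlonglongrightarrow> 0"
      by real_asymp
    then show ?thesis
      unfolding S_def by (subst stirling_duplication) auto
  qed
  ultimately have "L = 0"
    using LIMSEQ_unique by fastforce
  \<comment> \<open>Monotonicity extends the limit from integers to real arguments: the error term
    stays below 0, and any c < 0 is exceeded from some integer on.\<close>
  have le_0: "?s x \<le> 0" if x: "0 < x" for x
  proof -
    have "\<forall>\<^sub>F n in sequentially. x \<le> real (Suc n)"
      by real_asymp
    then have "\<forall>\<^sub>F n in sequentially. ?s x \<le> S n"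
      unfolding S_def by eventually_elim (rule mono[OF x])
    with L \<open>L = 0\<close> show ?thesis
      by (intro tendsto_lowerbound[of S 0 sequentially]) auto
  qed
  show ?thesis
  proof (rule order_tendstoI)
    fix c :: real assume "0 < c"
    have "?s x < c" if "0 < x" for x
      using le_0[OF that] \<open>0 < c\<close> by (rule le_less_trans)
    then show "\<forall>\<^sub>F x in at_top. ?s x < c"
      by (rule eventually_mono[OF eventually_gt_at_top[of 0]])
  next
    fix c :: real assume "c < 0"
    then have "\<forall>\<^sub>F n in sequentially. c < S n"
      using order_tendstoD(1)[OF L] \<open>L = 0\<close> by simp
    then obtain n where "c < S n"
      by (metis eventually_sequentially order_refl)
    show "\<forall>\<^sub>F x in at_top. c < ?s x"
      using eventually_ge_at_top[of "real (Suc n)"]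
    proof eventually_elim
      case (elim x)
      then show ?case
        using mono[of "real (Suc n)" x] \<open>c < S n\<close> unfolding S_def by simp
    qed
  qed
qed

lemma stirling_deriv_tendsto_0: "(stirling_deriv e a n \<longlongrightarrow> 0) at_top"
proof (cases n)
  case 0
  have "((\<lambda>x. stirling_deriv 0 0 0 x + e * Polygamma (Suc 0) (x + a)) \<longlongrightarrow> 0 + e * 0) at_top"
    by (intro tendsto_intros stirling_tendsto_0 Polygamma_Suc_tendsto_0)
  then show ?thesis
    using 0 by simp
qed (simp only: stirling_deriv_Suc_tendsto_0)

section \<open>Complete monotonicity of the Stirling remainder\<close>

text \<open>With the limit at order 0 now known, monotonicity settles that order too, so the signs
  at all orders can be combined.\<close>

lemma completely_monotonic_stirling_deriv:
  assumes R: "shift_rational R" and a: "0 \<le> a"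
    and eq: "\<And>x. 0 < x \<Longrightarrow> \<sigma> * step_deriv e a 0 x = R x"
  shows "completely_monotonic_on {0<..} (\<lambda>x. \<sigma> * stirling_deriv e a 0 x)"
proof -
  have "0 \<le> (-1) ^ n * (\<sigma> * stirling_deriv e a n x)" if x: "0 < x" for n x
  proof -
    consider "n = 0" | "n = Suc 0" | m where "n = Suc (Suc m)"
      by (metis not0_implies_Suc)
    then show ?thesis
    proof cases
      case 1
      have "0 \<le> \<sigma> * stirling_deriv e a 0 x"
      proof (rule nonneg_if_step_antimono_tendsto_0
          [where F = "\<lambda>x. \<sigma> * stirling_deriv e a 0 x"])
        show "((\<lambda>x. \<sigma> * stirling_deriv e a 0 x) \<longlongrightarrow> 0) at_top"
          by (intro tendsto_mult_right_zero stirling_deriv_tendsto_0)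
      next
        fix y assume "x \<le> y"
        then show "\<sigma> * stirling_deriv e a 0 (y + 1) \<le> \<sigma> * stirling_deriv e a 0 y"
          using x by (intro stirling_deriv_antimono[OF R a eq]) auto
      qed
      with 1 show ?thesis
        by simp
    next
      case 2
      then show ?thesis
        using stirling_deriv_sign_1[OF R a eq x] by simp
    next
      case 3
      then show ?thesis
        using stirling_deriv_sign[OF R a eq x, of m] by (simp only: power_Suc mult_ac mult_minus1 minus_minus)
    qed
  qed
  then show ?thesis
    unfolding completely_monotonic_on_def using a
    by (intro conjI exI[of _ "\<lambda>n x. \<sigma> * stirling_deriv e a n x"])
      (auto intro!: DERIV_cmult has_field_derivative_at_within[OF DERIV_stirling_deriv]
        simp: is_interval_io simp del: stirling_deriv.simps)
qed

section \<open>Necessity of the conditions on the parameters\<close>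

lemma stirling_remainder_neg_near_0:
  assumes "0 < a"
  shows "\<exists>x>0. stirling_remainder a x < 0"
proof -
  \<comment> \<open>Replacing ln Gamma(x) by ln Gamma(x + 1) - ln x isolates (1/2) ln x; the rest
    has a finite limit at 0 because the trigamma function is finite at a > 0.\<close>
  have lim: "((\<lambda>x. 1/2 * ln (2 * pi) - x + x * ln x - ln (Gamma (x + 1)) + 1/12 * Polygamma 1 (x + a))
      \<longlongrightarrow> 1/2 * ln (2 * pi) - 0 + 0 - ln (Gamma (0 + 1)) + 1/12 * Polygamma 1 (0 + a)) (at_right 0)"
    using assms by (intro tendsto_intros pos_not_nonpos_Ints) (auto, real_asymp)
  have "filterlim (\<lambda>x::real. 1/2 * ln x) at_bot (at_right 0)"
    by real_asymp
  then have "filterlim (\<lambda>x. (1/2 * ln (2 * pi) - x + x * ln x - ln (Gamma (x + 1)) + 1/12 * Polygamma 1 (x + a))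
      + 1/2 * ln x) at_bot (at_right 0)"
    by (rule filterlim_tendsto_add_at_bot_iff[OF lim, THEN iffD2])
  then have "\<forall>\<^sub>F x in at_right 0. (1/2 * ln (2 * pi) - x + x * ln x - ln (Gamma (x + 1))
      + 1/12 * Polygamma 1 (x + a)) + 1/2 * ln x < 0"
    unfolding filterlim_at_bot_dense by blast
  moreover have "\<forall>\<^sub>F x in at_right 0. (0::real) < x"
    by (simp add: eventually_at_right_less)
  ultimately have "\<forall>\<^sub>F x in at_right 0. 0 < x \<and> stirling_remainder a x < 0"
  proof eventually_elim
    case (elim x)
    have "ln (Gamma (x + 1)) = ln x + ln (Gamma x)"
      using elim(2) Gamma_plus1[of x] pos_not_nonpos_Ints[of x] Gamma_real_pos[of x]
      by (simp add: ln_mult del: Gamma_real_pos)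
    with elim show ?case
      using assms pos_not_nonpos_Ints[of "x + a"]
      by (simp add: stirling_remainder_def deriv_Polygamma algebra_simps)
  qed
  then show ?thesis
    using eventually_happens'[OF trivial_limit_at_right_real] by blast
qed

lemma stirling_deriv_2_pos_at_infinity:
  assumes "0 \<le> a" "a < 1/2"
  shows "\<exists>x>0. 0 < stirling_deriv (1/12) a (Suc (Suc 0)) x"
proof -
  \<comment> \<open>Beyond a^2/(1 - 2a) the numerator (1 - 2a)y - a^2 is positive; the maximum with
    1 keeps y positive.\<close>
  define X where "X = max 1 (a ^ 2 / (1 - 2 * a) + 1)"
  have step: "0 < step_deriv (1/12) a 0 y" if y: "X \<le> y" for y
  proof -
    define p q r where "p = 1 / y" and "q = 1 / (y + 1)" and "r = 1 / (y + a)"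
    have "0 < y" "a ^ 2 / (1 - 2 * a) < y"
      using y by (auto simp: X_def)
    then have pos: "0 < p" "0 < q" "0 < r" and "a ^ 2 < (1 - 2 * a) * y"
      using assms by (auto simp: p_def q_def r_def field_simps)
    then have "a ^ 2 * p < 1 - 2 * a"
      using \<open>0 < y\<close> by (simp add: p_def field_simps)
    then have "0 < (1 - 2 * a - a ^ 2 * p) * (q * (r * r)) * (p * q + r * r)"
      using pos by (intro mult_pos_pos add_pos_pos) auto
    also have "\<dots> = 2 * step_deriv (1/12) a 0 y"
      using step_deriv_0_shifted[OF \<open>0 < y\<close> assms(1)]
      unfolding add_0_right p_def[symmetric] q_def[symmetric] r_def[symmetric]
      by (simp add: algebra_simps)
    finally show ?thesis
      by simp
  qed
  have X: "0 < X"
    by (simp add: X_def)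
  \<comment> \<open>The limit argument only gives a weak inequality, so it is used at X + 1; the
    strict step down from X then makes the value at X positive.\<close>
  have "0 \<le> stirling_deriv (1/12) a (Suc (Suc 0)) (X + 1)"
  proof (rule nonneg_if_step_antimono_tendsto_0[OF stirling_deriv_tendsto_0])
    fix y assume "X + 1 \<le> y"
    then show "stirling_deriv (1/12) a (Suc (Suc 0)) (y + 1) \<le> stirling_deriv (1/12) a (Suc (Suc 0)) y"
      using X step[of y] stirling_deriv_diff[of y a "1/12" 0] assms
      by (simp del: stirling_deriv.simps)
  qed
  also have "\<dots> < stirling_deriv (1/12) a (Suc (Suc 0)) X"
    using X step[of X] stirling_deriv_diff[of X a "1/12" 0] assms
    by (simp del: stirling_deriv.simps)
  finally show ?thesis
    using X by blast
qed

theorem theorem3p1: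
  fixes \<alpha> \<beta> :: real
  assumes "\<alpha> \<ge> 0" and "\<beta> \<ge> 0"
  shows "(completely_monotonic_on {0<..} (stirling_remainder \<alpha>) \<longleftrightarrow> \<alpha> = 0) \<and>
         (completely_monotonic_on {0<..} (\<lambda>x. - stirling_remainder \<beta> x) \<longleftrightarrow> \<beta> \<ge> 1/2)"
proof (intro conjI iffI)
  assume cm: "completely_monotonic_on {0<..} (stirling_remainder \<alpha>)"
  show "\<alpha> = 0"
  proof (rule ccontr)
    assume "\<alpha> \<noteq> 0"
    then obtain x where "0 < x" "stirling_remainder \<alpha> x < 0"
      using stirling_remainder_neg_near_0[of \<alpha>] assms by auto
    with completely_monotonic_on_nonneg[OF cm, of x] show False
      by simp
  qed
next
  assume "\<alpha> = 0"
  moreover have "completely_monotonic_on {0<..} (\<lambda>x. 1 * stirling_deriv (1/12) 0 0 x)"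
    by (rule completely_monotonic_stirling_deriv[OF _ order.refl step_deriv_0_unshifted])
      (intro shift_rational.intros; simp)
  ultimately show "completely_monotonic_on {0<..} (stirling_remainder \<alpha>)"
    by (subst completely_monotonic_on_cong) (auto simp: stirling_remainder_eq simp del: stirling_deriv.simps)
next
  assume cm: "completely_monotonic_on {0<..} (\<lambda>x. - stirling_remainder \<beta> x)"
  \<comment> \<open>Order 2 suffices: for \<beta> < 1/2 the second derivative of the remainder is
    positive somewhere.\<close>
  have "0 \<le> (-1) ^ Suc (Suc 0) * - stirling_deriv (1/12) \<beta> (Suc (Suc 0)) x" if "0 < x" for x
  proof (rule completely_monotonic_on_derivatives_nonneg
      [OF cm, where G = "\<lambda>n x. - stirling_deriv (1/12) \<beta> n x"])
    fix n x assume "x \<in> {0::real<..}"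
    then have x: "0 < x"
      by simp
    show "- stirling_deriv (1/12) \<beta> 0 x = - stirling_remainder \<beta> x"
      by (simp only: stirling_remainder_eq[OF x assms(2)])
    show "((\<lambda>x. - stirling_deriv (1/12) \<beta> n x) has_real_derivative
        - stirling_deriv (1/12) \<beta> (Suc n) x) (at x)"
      by (intro DERIV_minus DERIV_stirling_deriv x assms(2))
  qed (use that in auto)
  then have "stirling_deriv (1/12) \<beta> (Suc (Suc 0)) x \<le> 0" if "0 < x" for x
    using that by (simp del: stirling_deriv.simps)
  then show "\<beta> \<ge> 1/2"
    using stirling_deriv_2_pos_at_infinity[of \<beta>] assms by (metis not_le)
next
  assume "\<beta> \<ge> 1/2"
  \<comment> \<open>For \<beta> at least 1/2 the coefficient 2 \<beta> - 1 in
    \<open>step_deriv_0_shifted\<close> is nonnegative, so its right side belongs to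
    \<open>shift_rational\<close>.\<close>
  then have "completely_monotonic_on {0<..} (\<lambda>x. - 1 * stirling_deriv (1/12) \<beta> 0 x)"
    using assms
    by (intro completely_monotonic_stirling_deriv[OF _ assms(2) step_deriv_0_shifted[OF _ assms(2)]])
      (intro shift_rational.intros; simp)
  then show "completely_monotonic_on {0<..} (\<lambda>x. - stirling_remainder \<beta> x)"
    using assms by (subst completely_monotonic_on_cong)
      (auto simp: stirling_remainder_eq simp del: stirling_deriv.simps)
qed

end
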